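(* Let $T=\{x_\alpha:\alpha<\mathfrak b\}\subseteq[\mathbb N]^\infty$ be an unbounded tower. For every space $Y$ satisfying $\mathsf S_1(\mathrm B_\Gamma,\mathrm B_\Gamma)$, the product space $(T\cup\mathrm{Fin})\times Y$ satisfies $\mathsf S_1(\Gamma,\Gamma)$.
   Context: Identify $P(\mathbb N)$ with the Cantor space $\{0,1\}^{\mathbb N}$; $[\mathbb N]^\infty$ and $\mathrm{Fin}$ are the infinite and finite subsets of $\mathbb N$, and $T\cup\mathrm{Fin}$ has the subspace topology. Each $x\in[\mathbb N]^\infty$ is identified with its increasing enumeration in $\mathbb N^{\mathbb N}$; a set is unbounded if it is unbounded in $\mathbb N^{\mathbb N}$ with respect to eventual domination $\le^*$. $\mathfrak b$ is the least cardinality of a $\le^*$-unbounded subset of $\mathbb N^{\mathbb N}$. $\{x_\alpha:\alpha<\kappa\}$ is a tower if $x_\beta\setminus x_\alpha$ is finite whenever $\alpha<\beta$. A cover of a space $Z$ is a family $\mathcal U$ with $Z=\bigcup\mathcal U$ and $Z$ not contained in a single member. $\Gamma(Z)$ is the family of open $\gamma$-covers of $Z$ (infinite, each point in all but finitely many members), and $\mathrm B_\Gamma(Z)$ the family of countable Borel $\gamma$-covers. $\mathsf S_1(\mathscr A,\mathscr B)$: for every sequence $(\mathcal U_n)$ in $\mathscr A(Z)$ there are $U_n\in\mathcal U_n$ with $\{U_n:n\in\mathbb N\}\in\mathscr B(Z)$. *)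

theory Defs
  imports "HOL-Analysis.Analysis"
begin

unbundle cardinal_syntax

definition eventually_dominated :: "(nat \<Rightarrow> nat) \<Rightarrow> (nat \<Rightarrow> nat) \<Rightarrow> bool" (infix "\<le>\<^sup>*" 50)
  where "f \<le>\<^sup>* g \<longleftrightarrow> (\<forall>\<^sub>F n in sequentially. f n \<le> g n)"

definition unbounded_family :: "(nat \<Rightarrow> nat) set \<Rightarrow> bool"
  where "unbounded_family F \<longleftrightarrow> (\<nexists>g. \<forall>f\<in>F. f \<le>\<^sup>* g)"

lemma unbounded_family_UNIV: "unbounded_family UNIV"
proof -
  have "\<not> (\<lambda>n. Suc (g n)) \<le>\<^sup>* g" for g :: "nat \<Rightarrow> nat"
    by (auto simp: eventually_dominated_def eventually_sequentially)
  then show ?thesis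
    unfolding unbounded_family_def by blast
qed

text \<open>
  Cardinals are well-orders of minimal order type, taken up to \<open>=o\<close>. The choice below
  selects one representative of the least cardinality; the two lemmas after it show that
  the minimum is attained.
\<close>

definition bounding_number :: "(nat \<Rightarrow> nat) rel"  (\<open>\<bb>\<close>)
  where "\<bb> = |SOME F. unbounded_family F \<and> (\<forall>G. unbounded_family G \<longrightarrow> |F| \<le>o |G| )|"

lemma ex_unbounded_family_least:
  "\<exists>F. unbounded_family F \<and> (\<forall>G. unbounded_family G \<longrightarrow> |F| \<le>o |G| )"
proof -
  let ?R = "{|F| | F. unbounded_family F}"
  have "?R \<noteq> {}" and "\<forall>r\<in>?R. Card_order r"
    using unbounded_family_UNIV card_of_Card_order by blast+
  from exists_minim_Card_order[OF this] show ?thesis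
    by blast
qed

lemma bounding_number_least:
  "\<exists>F. unbounded_family F \<and> \<bb> =o |F|"
  "unbounded_family G \<Longrightarrow> \<bb> \<le>o |G|"
  using someI_ex[OF ex_unbounded_family_least] unfolding bounding_number_def
  by (blast intro: ordIso_reflexive card_of_Card_order card_of_refl)+

text \<open>The ordinals below the cardinal \<open>\<kappa>\<close> are the elements of \<open>Field \<kappa>\<close>.\<close>

definition tower :: "'i rel \<Rightarrow> ('i \<Rightarrow> nat set) \<Rightarrow> bool"
  where "tower \<kappa> x \<longleftrightarrow> (\<forall>\<alpha>\<in>Field \<kappa>. \<forall>\<beta>\<in>Field \<kappa>.
    (\<alpha>, \<beta>) \<in> \<kappa> \<and> \<alpha> \<noteq> \<beta> \<longrightarrow> finite (x \<beta> - x \<alpha>))"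

definition cantor_space :: "nat set topology"
  where "cantor_space = pullback_topology UNIV (\<lambda>A n. n \<in> A)
    (product_topology (\<lambda>n. discrete_topology (UNIV :: bool set)) (UNIV :: nat set))"

definition cover :: "'a topology \<Rightarrow> 'a set set \<Rightarrow> bool"
  where "cover Z \<U> \<longleftrightarrow> topspace Z = \<Union>\<U> \<and> (\<forall>U\<in>\<U>. \<not> topspace Z \<subseteq> U)"

definition gamma_cover :: "'a topology \<Rightarrow> 'a set set \<Rightarrow> bool"
  where "gamma_cover Z \<U> \<longleftrightarrow>
    cover Z \<U> \<and> infinite \<U> \<and> (\<forall>z\<in>topspace Z. finite {U\<in>\<U>. z \<notin> U})"

definition borel_sets_of :: "'a topology \<Rightarrow> 'a set set"
  where "borel_sets_of Z = sigma_sets (topspace Z) {U. openin Z U}"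

definition open_gamma_covers :: "'a topology \<Rightarrow> 'a set set set"  (\<open>\<Gamma>\<close>)
  where "\<Gamma> Z = {\<U>. gamma_cover Z \<U> \<and> (\<forall>U\<in>\<U>. openin Z U)}"

definition countable_borel_gamma_covers :: "'a topology \<Rightarrow> 'a set set set"  (\<open>B\<^sub>\<Gamma>\<close>)
  where "B\<^sub>\<Gamma> Z = {\<U>. gamma_cover Z \<U> \<and> countable \<U> \<and> \<U> \<subseteq> borel_sets_of Z}"

text \<open>
  A space \<open>Z\<close> satisfies \<open>S\<^sub>1\<close> if \<open>S1 \<A> \<B> Z\<close> holds. The selected family is required to be in
  \<open>\<B> Z\<close> as a set, so repetitions in the sequence \<open>U\<close> are not counted.
\<close>

definition S1 ::
  "('a topology \<Rightarrow> 'a set set set) \<Rightarrow> ('a topology \<Rightarrow> 'a set set set) \<Rightarrow> 'a topology \<Rightarrow> bool"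
  where "S1 \<A> \<B> Z \<longleftrightarrow> (\<forall>\<U> :: nat \<Rightarrow> 'a set set. (\<forall>n. \<U> n \<in> \<A> Z) \<longrightarrow>
    (\<exists>U. (\<forall>n. U n \<in> \<U> n) \<and> range U \<in> \<B> Z))"

end

theory Submission
  imports Defs
begin

text \<open>
  The hypothesis on \<open>Y\<close> makes countably many natural-number valued Borel functions on \<open>Y\<close>
  simultaneously bounded, up to finitely many of them at each point. Applied to the points
  \<open>(s, y)\<close> with \<open>s\<close> finite, this yields \<open>a\<^sub>0 < a\<^sub>1 < \<dots>\<close> and \<open>m\<^sub>j \<ge> j\<close> such that for each \<open>y\<close>
  and almost all \<open>j\<close>, a set \<open>v\<close> missing \<open>[a\<^sub>j, a\<^sub>j\<^sub>+\<^sub>1)\<close> has \<open>(v, y)\<close> in the \<open>m\<^sub>j\<close>-th member of each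
  of the first \<open>j\<close> covers. Unboundedness of \<open>T\<close> gives an \<open>\<alpha>\<close> for which \<open>x\<^sub>\<alpha>\<close> misses these
  intervals for all \<open>j\<close> in some infinite \<open>I\<close>; then all finite sets, and all \<open>x\<^sub>\<beta>\<close> with
  \<open>\<beta> \<ge> \<alpha>\<close>, miss almost all of them. The fewer than \<open>\<bb>\<close> remaining \<open>x\<^sub>\<beta>\<close> only need the index
  chosen from the \<open>n\<close>-th cover to be at least some \<open>h(n)\<close>, which is achieved by the index
  \<open>m\<^sub>j\<close> for a large enough \<open>j \<in> I\<close>.
\<close>

section \<open>Gamma-covers given by sequences, and boundedness of Borel images\<close>

lemma openin_borel_sets_of: "openin Z U \<Longrightarrow> U \<in> borel_sets_of Z"
  by (simp add: borel_sets_of_def)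

lemma sigma_algebra_borel_sets_of: "sigma_algebra (topspace Z) (borel_sets_of Z)"
  unfolding borel_sets_of_def
  by (rule sigma_algebra_sigma_sets) (auto dest: openin_subset)

text \<open>Repetitions in the sequence are harmless: if the range were finite, some member would
  occur infinitely often, and a point outside that member would be missed infinitely often.\<close>

lemma gamma_cover_range:
  assumes sub: "\<And>n. U n \<subseteq> topspace Z"
    and proper: "\<And>n. \<not> topspace Z \<subseteq> U n"
    and ev: "\<And>z. z \<in> topspace Z \<Longrightarrow> \<forall>\<^sub>F n in sequentially. z \<in> U n"
  shows "gamma_cover Z (range U)"
proof -
  have fin: "finite {n. z \<notin> U n}" if "z \<in> topspace Z" for z
    using ev[OF that] by (simp add: cofinite_eq_sequentially[symmetric] eventually_cofinite)
  have "topspace Z \<subseteq> \<Union>(range U)"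
    using ev by (fastforce simp: eventually_sequentially)
  moreover have "infinite (range U)"
  proof
    assume "finite (range U)"
    then obtain V where V: "V \<in> range U" "infinite {n. U n = V}"
      using inf_img_fin_dom[of U UNIV] by (auto simp: vimage_def)
    obtain z where "z \<in> topspace Z" "z \<notin> V"
      using V(1) proper by auto
    then have "{n. U n = V} \<subseteq> {n. z \<notin> U n}" by auto
    with fin[OF \<open>z \<in> topspace Z\<close>] V(2) show False
      using finite_subset by blast
  qed
  moreover have "finite {V \<in> range U. z \<notin> V}" if "z \<in> topspace Z" for z
  proof -
    have "{V \<in> range U. z \<notin> V} = U ` {n. z \<notin> U n}" by auto
    with fin[OF that] show ?thesis by simp
  qed
  ultimately show ?thesis
    using sub proper by (fastforce simp: gamma_cover_def cover_def)
qed

lemma gamma_cover_sequence: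
  assumes "gamma_cover Z \<U>"
  obtains e :: "nat \<Rightarrow> 'a set" where "\<And>m. e m \<in> \<U>"
    and "\<And>z. z \<in> topspace Z \<Longrightarrow> \<forall>\<^sub>F m in sequentially. z \<in> e m"
proof -
  obtain e :: "nat \<Rightarrow> 'a set" where e: "inj e" "range e \<subseteq> \<U>"
    using assms infinite_countable_subset[of \<U>] by (auto simp: gamma_cover_def)
  have "\<forall>\<^sub>F m in sequentially. z \<in> e m" if "z \<in> topspace Z" for z
  proof -
    have "finite {U \<in> \<U>. z \<notin> U}"
      using assms that by (simp add: gamma_cover_def)
    then have "finite (e -` {U \<in> \<U>. z \<notin> U})"
      using e(1) by (rule finite_vimageI)
    moreover have "e -` {U \<in> \<U>. z \<notin> U} = {m. z \<notin> e m}"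
      using e(2) by auto
    ultimately show ?thesis
      by (simp add: cofinite_eq_sequentially[symmetric] eventually_cofinite)
  qed
  with e(2) show ?thesis by (intro that) auto
qed

text \<open>
  This says that Borel images of \<open>Y\<close> in the Baire space are bounded, where
  \<open>A n k\<close> is the set of points whose image has \<open>n\<close>-th value at most \<open>k\<close>.
\<close>

lemma S1_borel_gamma_bounded:
  fixes A :: "nat \<Rightarrow> nat \<Rightarrow> 'b set"
  assumes S1: "S1 B\<^sub>\<Gamma> B\<^sub>\<Gamma> Y"
    and borel: "\<And>n k. A n k \<in> borel_sets_of Y"
    and mono: "\<And>n k l. k \<le> l \<Longrightarrow> A n k \<subseteq> A n l"
    and ex: "\<And>n y. y \<in> topspace Y \<Longrightarrow> \<exists>k. y \<in> A n k"
  obtains g where "\<And>y. y \<in> topspace Y \<Longrightarrow> \<forall>\<^sub>F n in sequentially. y \<in> A n (g n)"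
proof -
  interpret sigma_algebra "topspace Y" "borel_sets_of Y"
    by (rule sigma_algebra_borel_sets_of)
  \<comment> \<open>Besides increasing in \<open>k\<close>, the sets now decrease in
    \<open>n\<close>, so a bound found for a later index also serves an earlier one. This is what
    allows passing to a subsequence below.\<close>
  define C where "C n k = (\<Inter>i\<le>n. A i k)" for n k
  have C_borel: "C n k \<in> borel_sets_of Y" for n k
    unfolding C_def by (rule finite_INT) (auto simp: borel)
  have C_sub: "C n k \<subseteq> topspace Y" for n k
    using C_borel sets_into_space by blast
  have C_mono: "C n k \<subseteq> C n l" if "k \<le> l" for n k l
    using mono[OF that] by (auto simp: C_def)
  have C_anti: "C n k \<subseteq> C m k" if "m \<le> n" for n m k
    using that by (auto simp: C_def)
  have C_A: "C n k \<subseteq> A m k" if "m \<le> n" for n m k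
    using that by (auto simp: C_def)
  have C_ex: "\<exists>k. y \<in> C n k" if y: "y \<in> topspace Y" for y n
  proof -
    obtain f where f: "\<And>i. y \<in> A i (f i)" using ex[OF y] by metis
    have "y \<in> A i (Max (f ` {..n}))" if "i \<le> n" for i
      using that f[of i] mono[of "f i" "Max (f ` {..n})" i] by auto
    then show ?thesis by (auto simp: C_def)
  qed
  show thesis
  \<comment> \<open>A member of a cover may not be the whole space. If \<open>C n0\<close> never
    reaches it, neither does any later row, so the covers are taken from row \<open>n0\<close> on;
    otherwise every row has a bound uniform in \<open>y\<close>.\<close>
  proof (cases "\<forall>n. \<exists>k. C n k = topspace Y")
    case True
    then obtain g where g: "\<And>n. C n (g n) = topspace Y" by metis
    then have "topspace Y \<subseteq> A n (g n)" for n
      using C_A[of n n "g n"] by simp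
    then show thesis
      by (intro that[of g] always_eventually allI) blast
  next
    case False
    then obtain n0 where n0: "\<And>k. C n0 k \<noteq> topspace Y" by auto
    define D where "D n = C (n0 + n)" for n
    have D_proper: "\<not> topspace Y \<subseteq> D n k" for n k
      using n0[of k] C_anti[of n0 "n0 + n" k] C_sub[of n0 k] by (auto simp: D_def)
    have ev: "\<forall>\<^sub>F k in sequentially. y \<in> D n k" if y: "y \<in> topspace Y" for y n
    proof -
      obtain k where "y \<in> D n k" using C_ex[OF y] by (auto simp: D_def)
      then show ?thesis
        using C_mono[of k _ "n0 + n"] by (auto simp: D_def eventually_sequentially)
    qed
    have "gamma_cover Y (range (D n))" for n
      using D_proper C_sub ev by (intro gamma_cover_range) (auto simp: D_def)
    then have "\<forall>n. range (D n) \<in> B\<^sub>\<Gamma> Y"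
      using C_borel by (auto simp: countable_borel_gamma_covers_def D_def)
    then obtain V where V: "\<And>n. V n \<in> range (D n)" "range V \<in> B\<^sub>\<Gamma> Y"
      using S1[unfolded S1_def, rule_format, of "\<lambda>n. range (D n)"] by blast
    have "\<forall>n. \<exists>l. V n = D n l" using V(1) by auto
    then obtain k where k: "\<And>n. V n = D n (k n)" by metis
    have gV: "gamma_cover Y (range V)"
      using V(2) by (simp add: countable_borel_gamma_covers_def)
    \<comment> \<open>\<open>S1\<close> controls only the set of selected members. With one index
      kept for each member, missing finitely many members means missing finitely many indices in
      \<open>J\<close>; the gaps of \<open>J\<close> are then filled by moving from \<open>n\<close>
      up to \<open>p n\<close> in \<open>J\<close>.\<close>
    obtain J where J: "inj_on V J" "range V = V ` J"
      using subset_image_inj[of "range V" V UNIV] by auto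
    have "infinite J"
      using gV J(2) by (auto simp: gamma_cover_def)
    then have "\<forall>n. \<exists>j\<in>J. n \<le> j"
      using infinite_nat_iff_unbounded_le by blast
    then obtain p where p: "\<And>n. p n \<in> J" "\<And>n. n \<le> p n" by metis
    show thesis
    proof (rule that[of "\<lambda>n. k (p n)"])
      fix y assume y: "y \<in> topspace Y"
      have "finite {U \<in> range V. y \<notin> U}"
        using gV y by (simp add: gamma_cover_def)
      moreover have "V ` {j \<in> J. y \<notin> V j} \<subseteq> {U \<in> range V. y \<notin> U}" by auto
      ultimately have "finite (V ` {j \<in> J. y \<notin> V j})"
        by (rule rev_finite_subset)
      then have "finite {j \<in> J. y \<notin> V j}"
        by (rule finite_imageD) (rule inj_on_subset[OF J(1)], auto)
      then obtain N where N: "\<And>j. j \<in> J \<Longrightarrow> y \<notin> V j \<Longrightarrow> j < N"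
        by (auto simp: finite_nat_iff_bounded)
      have "y \<in> A n (k (p n))" if "n \<ge> N" for n
      proof -
        have "y \<in> V (p n)" using N[of "p n"] p[of n] that by force
        then show ?thesis
          using C_A[of n "n0 + p n"] p(2)[of n] by (auto simp: k D_def)
      qed
      then show "\<forall>\<^sub>F n in sequentially. y \<in> A n (k (p n))"
        by (auto simp: eventually_sequentially)
    qed
  qed
qed

section \<open>Cylinders in the Cantor space, tubes in the product, and the gap sequence\<close>

lemma topspace_cantor_space [simp]: "topspace cantor_space = UNIV"
  by (simp add: cantor_space_def topspace_pullback_topology)

text \<open>A basic open set of the product restricts only finitely many coordinates, and
  \<open>b\<close> is chosen above all of them.\<close>

lemma openin_cantor_space_initial_segment:
  assumes "openin cantor_space Q" "s \<in> Q"
  obtains b where "\<And>x. x \<inter> {..<b} = s \<inter> {..<b} \<Longrightarrow> x \<in> Q"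
proof -
  obtain R where R: "openin (product_topology (\<lambda>n. discrete_topology (UNIV :: bool set)) (UNIV :: nat set)) R"
    and Q: "Q = (\<lambda>A n. n \<in> A) -` R"
    using assms(1) by (auto simp: cantor_space_def openin_pullback_topology)
  have "(\<lambda>n. n \<in> s) \<in> R" using assms(2) Q by simp
  with R obtain X where X: "finite {i. X i \<noteq> (UNIV :: bool set)}"
    "(\<lambda>n. n \<in> s) \<in> Pi\<^sub>E UNIV X" "Pi\<^sub>E UNIV X \<subseteq> R"
    unfolding openin_product_topology_alt by fastforce
  obtain b where b: "{i. X i \<noteq> UNIV} \<subseteq> {..<b}"
    using X(1) finite_nat_iff_bounded by blast
  have "x \<in> Q" if x: "x \<inter> {..<b} = s \<inter> {..<b}" for x
  proof -
    have "(n \<in> x) \<in> X n" for n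
    proof (cases "n < b")
      case True
      with x have "n \<in> x \<longleftrightarrow> n \<in> s" by blast
      with X(2) show ?thesis by (auto simp: PiE_iff)
    next
      case False
      with b have "X n = UNIV" by auto
      then show ?thesis by simp
    qed
    then show ?thesis using X(3) Q by (auto simp: PiE_iff subset_iff)
  qed
  then show thesis by (rule that)
qed

lemma openin_prod_slice:
  assumes "openin (prod_topology X Y) U" "x \<in> topspace X"
  shows "openin Y {y. (x, y) \<in> U}"
proof -
  have "continuous_map Y (prod_topology X Y) (\<lambda>y. (x, y))"
    using assms(2) by (intro continuous_map_pairedI) auto
  then have "openin Y {y \<in> topspace Y. (x, y) \<in> U}"
    using assms(1) by (rule openin_continuous_map_preimage)
  moreover have "{y \<in> topspace Y. (x, y) \<in> U} = {y. (x, y) \<in> U}"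
    using openin_subset[OF assms(1)] by auto
  ultimately show ?thesis by simp
qed

text \<open>The set of all \<open>y\<close> whose slice over the cylinder lies in \<open>U\<close>
  need not be open, as the cylinder in \<open>Z\<close> need not be compact. The union of open bases
  is open, hence Borel.\<close>

definition tube_base :: "nat set set \<Rightarrow> 'b topology \<Rightarrow> (nat set \<times> 'b) set \<Rightarrow> nat set \<Rightarrow> nat \<Rightarrow> 'b set"
  where "tube_base Z Y U s b =
    \<Union>{V. openin Y V \<and> {x \<in> Z. x \<inter> {..<b} = s \<inter> {..<b}} \<times> V \<subseteq> U}"

lemma openin_tube_base: "openin Y (tube_base Z Y U s b)"
  unfolding tube_base_def by (rule openin_Union) auto

lemma tube_base_mono:
  assumes "b \<le> c"
  shows "tube_base Z Y U s b \<subseteq> tube_base Z Y U s c"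
proof -
  have "{..<b} = {..<c} \<inter> {..<b}" using assms by auto
  then have "x \<inter> {..<b} = s \<inter> {..<b}" if "x \<inter> {..<c} = s \<inter> {..<c}" for x
    using that by (metis Int_assoc)
  then have "{x \<in> Z. x \<inter> {..<c} = s \<inter> {..<c}} \<subseteq> {x \<in> Z. x \<inter> {..<b} = s \<inter> {..<b}}"
    by blast
  then have "{x \<in> Z. x \<inter> {..<c} = s \<inter> {..<c}} \<times> V \<subseteq> U"
    if "{x \<in> Z. x \<inter> {..<b} = s \<inter> {..<b}} \<times> V \<subseteq> U" for V
    using that by (meson Sigma_mono order_refl order_trans)
  then show ?thesis
    unfolding tube_base_def by (intro Union_mono Collect_mono) simp
qed

lemma tube_baseD:
  assumes "y \<in> tube_base Z Y U s b" "x \<in> Z" "x \<inter> {..<b} = s \<inter> {..<b}"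
  shows "(x, y) \<in> U"
  using assms by (auto simp: tube_base_def)

lemma ex_tube_base:
  assumes U: "openin (prod_topology (subtopology cantor_space Z) Y) U" and sy: "(s, y) \<in> U"
  shows "\<exists>b. y \<in> tube_base Z Y U s b"
proof -
  obtain P V where PV: "openin (subtopology cantor_space Z) P" "openin Y V"
    "s \<in> P" "y \<in> V" "P \<times> V \<subseteq> U"
    using U sy unfolding openin_prod_topology_alt by metis
  obtain Q where Q: "openin cantor_space Q" "P = Q \<inter> Z"
    using PV(1) by (auto simp: openin_subtopology)
  obtain b where b: "\<And>x. x \<inter> {..<b} = s \<inter> {..<b} \<Longrightarrow> x \<in> Q"
    using openin_cantor_space_initial_segment[OF Q(1)] PV(3) Q(2) by blast
  have "{x \<in> Z. x \<inter> {..<b} = s \<inter> {..<b}} \<times> V \<subseteq> U"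
    using b Q(2) PV(5) by blast
  with PV(2,4) show ?thesis
    unfolding tube_base_def by blast
qed

text \<open>Boundedness is used twice. First it gives a cover index \<open>M c\<close> that works
  for all subsets of \<open>{..<c}\<close> and the covers up to \<open>c\<close>; then it gives a
  length \<open>B c\<close> of initial segments on which this persists for nearby sets. Iterating
  \<open>B\<close> yields \<open>a\<close>: a set missing the interval from \<open>a j\<close> to
  \<open>a (Suc j)\<close> looks like a subset of \<open>{..<a j}\<close> up to
  \<open>a (Suc j)\<close>.\<close>

lemma gap_sequence:
  fixes e :: "nat \<Rightarrow> nat \<Rightarrow> (nat set \<times> 'b) set"
  assumes S1: "S1 B\<^sub>\<Gamma> B\<^sub>\<Gamma> Y"
    and fin: "{s. finite s} \<subseteq> Z"
    and op: "\<And>n m. openin (prod_topology (subtopology cantor_space Z) Y) (e n m)"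
    and ev: "\<And>n x y. x \<in> Z \<Longrightarrow> y \<in> topspace Y \<Longrightarrow> \<forall>\<^sub>F m in sequentially. (x, y) \<in> e n m"
  shows "\<exists>a m :: nat \<Rightarrow> nat. strict_mono a \<and> (\<forall>j. j \<le> m j) \<and>
    (\<forall>y\<in>topspace Y. \<forall>\<^sub>F j in sequentially. \<forall>x\<in>Z. \<forall>n\<le>j.
      x \<inter> {a j..<a (Suc j)} = {} \<longrightarrow> (x, y) \<in> e n (m j))"
proof -
  interpret sigma_algebra "topspace Y" "borel_sets_of Y"
    by (rule sigma_algebra_borel_sets_of)
  define S where "S c k = {y \<in> topspace Y. \<forall>n\<le>c. \<forall>s\<in>Pow {..<c}. (s, y) \<in> e n k}" for c k
  have S_eq: "S c k = topspace Y \<inter> (\<Inter>p\<in>{..c} \<times> Pow {..<c}. {y. (snd p, y) \<in> e (fst p) k})" for c k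
    by (auto simp: S_def)
  have S_borel: "S c k \<in> borel_sets_of Y" for c k
    unfolding S_eq
    using fin by (intro Int top finite_INT openin_borel_sets_of openin_prod_slice[OF op])
      (auto dest: finite_subset)
  \<comment> \<open>\<open>S c\<close> need not be monotone in the index, but the intersections of
    its tails are.\<close>
  define A where "A c k = (\<Inter>l\<in>{k..}. S c l)" for c k
  obtain M0 where M0: "\<And>y. y \<in> topspace Y \<Longrightarrow> \<forall>\<^sub>F c in sequentially. y \<in> A c (M0 c)"
  proof (rule S1_borel_gamma_bounded[OF S1, of A])
    show "A c k \<in> borel_sets_of Y" for c k
      unfolding A_def by (rule countable_INT) (auto simp: S_borel)
    show "A c k \<subseteq> A c l" if "k \<le> l" for c k l
      using that by (auto simp: A_def)
    show "\<exists>k. y \<in> A c k" if y: "y \<in> topspace Y" for c y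
    proof -
      have "\<forall>\<^sub>F l in sequentially. \<forall>p\<in>{..c} \<times> Pow {..<c}. (snd p, y) \<in> e (fst p) l"
        using fin y by (intro eventually_ball_finite) (auto intro!: ev dest: finite_subset)
      then obtain k where "\<And>l p. l \<ge> k \<Longrightarrow> p \<in> {..c} \<times> Pow {..<c} \<Longrightarrow> (snd p, y) \<in> e (fst p) l"
        unfolding eventually_sequentially by blast
      then have "y \<in> A c k" using y by (fastforce simp: A_def S_def)
      then show ?thesis ..
    qed
  qed blast
  define M where "M c = max (M0 c) c" for c
  define W where "W c b = topspace Y \<inter> (\<Inter>p\<in>{..c} \<times> Pow {..<c}. tube_base Z Y (e (fst p) (M c)) (snd p) b)"
    for c b
  have W_borel: "W c b \<in> borel_sets_of Y" for c b
    unfolding W_def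
    by (intro Int top finite_INT openin_borel_sets_of openin_tube_base) auto
  have W_mono: "W c b \<subseteq> W c d" if "b \<le> d" for c b d
    by (auto simp: W_def intro: tube_base_mono[OF that, THEN subsetD])
  obtain B where B: "\<And>y. y \<in> topspace Y \<Longrightarrow>
    \<forall>\<^sub>F c in sequentially. y \<in> W c (B c) \<union> (topspace Y - S c (M c))"
  proof (rule S1_borel_gamma_bounded[OF S1, of "\<lambda>c b. W c b \<union> (topspace Y - S c (M c))"])
    show "W c b \<union> (topspace Y - S c (M c)) \<in> borel_sets_of Y" for c b
      by (intro Un compl_sets W_borel S_borel)
    show "W c b \<union> (topspace Y - S c (M c)) \<subseteq> W c d \<union> (topspace Y - S c (M c))" if "b \<le> d" for c b d
      using W_mono[OF that] by blast
    show "\<exists>b. y \<in> W c b \<union> (topspace Y - S c (M c))" if y: "y \<in> topspace Y" for c y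
    proof (cases "y \<in> S c (M c)")
      case True
      have "\<forall>p\<in>{..c} \<times> Pow {..<c}. \<exists>b. y \<in> tube_base Z Y (e (fst p) (M c)) (snd p) b"
        using True by (intro ballI ex_tube_base[OF op]) (auto simp: S_def)
      then obtain f where f: "\<And>p. p \<in> {..c} \<times> Pow {..<c} \<Longrightarrow>
          y \<in> tube_base Z Y (e (fst p) (M c)) (snd p) (f p)"
        by metis
      define b where "b = Max (f ` ({..c} \<times> Pow {..<c}))"
      have f_le: "f p \<le> b" if "p \<in> {..c} \<times> Pow {..<c}" for p
        unfolding b_def using that by (intro Max_ge) auto
      have "y \<in> tube_base Z Y (e (fst p) (M c)) (snd p) b" if "p \<in> {..c} \<times> Pow {..<c}" for p
        using f[OF that] by (rule subsetD[OF tube_base_mono[OF f_le[OF that]]])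
      then have "y \<in> W c b" using y by (auto simp: W_def)
      then show ?thesis by blast
    qed (use y in blast)
  qed blast
  define a where "a = rec_nat 0 (\<lambda>_ c. max (B c) (Suc c))"
  have a_Suc: "a (Suc j) = max (B (a j)) (Suc (a j))" for j
    by (simp add: a_def)
  have a: "strict_mono a"
    by (rule strict_mono_Suc_iff[THEN iffD2]) (simp add: a_Suc less_max_iff_disj)
  have a_ge: "j \<le> a j" for j
    using a by (rule strict_mono_imp_increasing)
  show ?thesis
  proof (rule exI[of _ a], rule exI[of _ "\<lambda>j. M (a j)"], intro conjI allI ballI)
    show "strict_mono a" by (rule a)
    show "j \<le> M (a j)" for j using a_ge[of j] by (simp add: M_def)
    fix y assume y: "y \<in> topspace Y"
    have "\<forall>\<^sub>F c in sequentially. y \<in> W c (B c)"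
      using M0[OF y] B[OF y]
      by eventually_elim (auto simp: A_def M_def)
    then have "\<forall>\<^sub>F j in sequentially. y \<in> W (a j) (B (a j))"
      using filterlim_subseq[OF a] by (rule eventually_compose_filterlim)
    then show "\<forall>\<^sub>F j in sequentially. \<forall>x\<in>Z. \<forall>n\<le>j.
      x \<inter> {a j..<a (Suc j)} = {} \<longrightarrow> (x, y) \<in> e n (M (a j))"
    proof (eventually_elim, intro ballI allI impI)
      fix j x n
      assume j: "y \<in> W (a j) (B (a j))" and x: "x \<in> Z" and n: "n \<le> j"
        and gap: "x \<inter> {a j..<a (Suc j)} = {}"
      have "y \<in> W (a j) (a (Suc j))"
        using j W_mono[of "B (a j)" "a (Suc j)" "a j"] by (auto simp: a_Suc)
      moreover have "(n, x \<inter> {..<a j}) \<in> {..a j} \<times> Pow {..<a j}"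
        using n a_ge[of j] by auto
      ultimately have "y \<in> tube_base Z Y (e n (M (a j))) (x \<inter> {..<a j}) (a (Suc j))"
        unfolding W_def by force
      \<comment> \<open>By the gap, \<open>x\<close> and its truncation at \<open>a j\<close> lie in
        the same cylinder of length \<open>a (Suc j)\<close>.\<close>
      moreover have "x \<inter> {..<a (Suc j)} = x \<inter> {..<a j} \<inter> {..<a (Suc j)}"
        using gap by (auto simp: disjoint_iff not_less)
      ultimately show "(x, y) \<in> e n (M (a j))"
        by (rule tube_baseD[OF _ x])
    qed
  qed
qed

section \<open>Unboundedness and the bounding number\<close>

lemma unbounded_family_infinite_gaps:
  assumes unb: "unbounded_family (enumerate ` T)"
    and inf: "\<forall>A\<in>T. infinite A"
    and a: "strict_mono a"
  shows "\<exists>A\<in>T. infinite {j. A \<inter> {a j..<a (Suc j)} = {}}"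
proof (rule ccontr)
  assume *: "\<not> ?thesis"
  \<comment> \<open>If \<open>A\<close> meets every interval from the \<open>k\<close>-th on, its
    \<open>n\<close>-th element is below \<open>a (Suc (k + n))\<close>. As \<open>k\<close> depends
    on \<open>A\<close>, it is absorbed by \<open>2 * n\<close> for \<open>n \<ge> k\<close>, giving
    one bound for all of \<open>T\<close>.\<close>
  have "enumerate A \<le>\<^sup>* (\<lambda>n. a (Suc (2 * n)))" if A: "A \<in> T" for A
  proof -
    have "finite {j. A \<inter> {a j..<a (Suc j)} = {}}" using * A by blast
    then obtain k where "\<forall>j\<in>{j. A \<inter> {a j..<a (Suc j)} = {}}. j < k"
      by (auto simp: finite_nat_iff_bounded)
    then have k: "\<exists>c\<in>A. a j \<le> c \<and> c < a (Suc j)" if "k \<le> j" for j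
      using that by fastforce
    have enum: "enumerate A n < a (Suc (k + n))" for n
    proof (induction n)
      case 0
      obtain c where "c \<in> A" "c < a (Suc k)" using k[of k] by auto
      then show ?case
        using Least_le[of "\<lambda>c. c \<in> A" c] by (simp add: enumerate_0)
    next
      case (Suc n)
      obtain c where c: "c \<in> A" "a (Suc (k + n)) \<le> c" "c < a (Suc (Suc (k + n)))"
        using k[of "Suc (k + n)"] by auto
      have "enumerate A (Suc n) \<le> c"
        using inf A c Suc by (subst enumerate_Suc'') (auto intro!: Least_le)
      with c show ?case by simp
    qed
    have "enumerate A n \<le> a (Suc (2 * n))" if "k \<le> n" for n
    proof -
      have "a (Suc (k + n)) \<le> a (Suc (2 * n))"
        using that strict_mono_less_eq[OF a] by simp
      with enum[of n] show ?thesis by linarith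
    qed
    then show ?thesis
      by (auto simp: eventually_dominated_def eventually_sequentially)
  qed
  with unb show False by (auto simp: unbounded_family_def)
qed

text \<open>Proper initial segments of a cardinal have smaller cardinality, here below
  \<open>\<bb>\<close>.\<close>

lemma bounded_if_below_bounding_number:
  fixes \<kappa> :: "'i rel" and f :: "'i \<Rightarrow> nat \<Rightarrow> nat"
  assumes \<kappa>: "Card_order \<kappa>" "\<kappa> =o \<bb>" and \<alpha>: "\<alpha> \<in> Field \<kappa>"
  shows "\<exists>h. \<forall>\<beta>\<in>underS \<kappa> \<alpha>. f \<beta> \<le>\<^sup>* h"
proof (rule ccontr)
  assume "\<not> ?thesis"
  then have "unbounded_family (f ` underS \<kappa> \<alpha>)" by (auto simp: unbounded_family_def)
  then have "\<bb> \<le>o |f ` underS \<kappa> \<alpha>|" by (rule bounding_number_least(2))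
  then have "\<kappa> \<le>o |underS \<kappa> \<alpha>|"
    using card_of_image \<kappa>(2) ordIso_ordLeq_trans ordLeq_transitive by blast
  moreover have "|underS \<kappa> \<alpha>| <o \<kappa>" using \<kappa>(1) \<alpha> by (rule card_of_underS)
  ultimately show False using not_ordLess_ordLeq by blast
qed

section \<open>Selection from the covers of the product\<close>

theorem theorem7p1:
  fixes \<kappa> :: "'i rel" and x :: "'i \<Rightarrow> nat set" and T :: "nat set set"
    and Y :: "'b topology"
  assumes "Card_order \<kappa>" and "\<kappa> =o \<bb>"
    and "T = x ` Field \<kappa>"
    and "\<forall>A\<in>T. infinite A"
    and "unbounded_family (enumerate ` T)"
    and "tower \<kappa> x"
    and "S1 B\<^sub>\<Gamma> B\<^sub>\<Gamma> Y"
  shows "S1 \<Gamma> \<Gamma> (prod_topology (subtopology cantor_space (T \<union> {s. finite s})) Y)"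
  unfolding S1_def
proof (intro allI impI)
  let ?Z = "T \<union> {s. finite s}"
  let ?P = "prod_topology (subtopology cantor_space ?Z) Y"
  fix \<U> :: "nat \<Rightarrow> (nat set \<times> 'b) set set"
  assume \<U>: "\<forall>n. \<U> n \<in> \<Gamma> ?P"
  have topP: "topspace ?P = ?Z \<times> topspace Y" by simp
  have "\<forall>n. \<exists>e :: nat \<Rightarrow> _. (\<forall>m. e m \<in> \<U> n) \<and>
      (\<forall>z\<in>topspace ?P. \<forall>\<^sub>F m in sequentially. z \<in> e m)"
  proof
    fix n
    have "gamma_cover ?P (\<U> n)"
      using \<U> by (simp add: open_gamma_covers_def)
    then show "\<exists>e :: nat \<Rightarrow> _. (\<forall>m. e m \<in> \<U> n) \<and>
        (\<forall>z\<in>topspace ?P. \<forall>\<^sub>F m in sequentially. z \<in> e m)"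
      by (rule gamma_cover_sequence) blast
  qed
  then obtain e :: "nat \<Rightarrow> nat \<Rightarrow> _" where e: "\<And>n m. e n m \<in> \<U> n"
    and "\<And>n z. z \<in> topspace ?P \<Longrightarrow> \<forall>\<^sub>F m in sequentially. z \<in> e n m"
    by metis
  then have ev: "\<And>n v y. v \<in> ?Z \<Longrightarrow> y \<in> topspace Y \<Longrightarrow> \<forall>\<^sub>F m in sequentially. (v, y) \<in> e n m"
    unfolding topP by blast
  have op: "openin ?P (e n m)" and proper: "\<not> topspace ?P \<subseteq> e n m" for n m
    using \<U> e[of n m] unfolding open_gamma_covers_def gamma_cover_def cover_def by blast+
  obtain a m where a: "strict_mono a" and m: "\<And>j. j \<le> m j"
    and gap: "\<And>y. y \<in> topspace Y \<Longrightarrow> \<forall>\<^sub>F j in sequentially. \<forall>v\<in>?Z. \<forall>n\<le>j.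
      v \<inter> {a j..<a (Suc j)} = {} \<longrightarrow> (v, y) \<in> e n (m j)"
    using gap_sequence[where e = e, OF assms(7) Un_upper2 op ev] by blast
  obtain A where A: "A \<in> T" "infinite {j. A \<inter> {a j..<a (Suc j)} = {}}"
    using unbounded_family_infinite_gaps[OF assms(5,4) a] by blast
  then obtain \<alpha> where \<alpha>: "\<alpha> \<in> Field \<kappa>" "A = x \<alpha>" using assms(3) by blast
  define I where "I = {j. A \<inter> {a j..<a (Suc j)} = {}}"
  \<comment> \<open>For fixed \<beta>, the least index from which on the \<open>n\<close>-th
    sequence contains \<open>(x \<beta>, y)\<close> is a Borel function of \<open>y\<close>, so one
    \<open>h\<close> serves all \<open>y\<close>.\<close>
  have "\<exists>h. \<forall>y\<in>topspace Y. \<forall>\<^sub>F n in sequentially. \<forall>k\<ge>h n. (x \<beta>, y) \<in> e n k"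
    if "\<beta> \<in> Field \<kappa>" for \<beta>
  proof -
    interpret sigma_algebra "topspace Y" "borel_sets_of Y"
      by (rule sigma_algebra_borel_sets_of)
    have x\<beta>: "x \<beta> \<in> ?Z" using that assms(3) by blast
    obtain h where "\<And>y. y \<in> topspace Y \<Longrightarrow>
        \<forall>\<^sub>F n in sequentially. y \<in> (\<Inter>k\<in>{h n..}. {y. (x \<beta>, y) \<in> e n k})"
    proof (rule S1_borel_gamma_bounded[OF assms(7), of "\<lambda>n l. \<Inter>k\<in>{l..}. {y. (x \<beta>, y) \<in> e n k}"])
      have "{y. (x \<beta>, y) \<in> e n k} \<in> borel_sets_of Y" for n k
        using openin_prod_slice[OF op] x\<beta> by (intro openin_borel_sets_of) auto
      then show "(\<Inter>k\<in>{l..}. {y. (x \<beta>, y) \<in> e n k}) \<in> borel_sets_of Y" for n l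
        by (intro countable_INT) auto
      show "\<exists>l. y \<in> (\<Inter>k\<in>{l..}. {y. (x \<beta>, y) \<in> e n k})" if "y \<in> topspace Y" for n y
        using ev[OF x\<beta> that, of n] by (auto simp: eventually_sequentially)
    qed auto
    then show ?thesis by (intro exI[of _ h]) (simp add: atLeast_def)
  qed
  then have "\<exists>f. \<forall>\<beta>\<in>Field \<kappa>. \<forall>y\<in>topspace Y.
      \<forall>\<^sub>F n in sequentially. \<forall>k\<ge>f \<beta> n. (x \<beta>, y) \<in> e n k"
    by (intro bchoice ballI)
  then obtain f where f: "\<And>\<beta> y. \<beta> \<in> Field \<kappa> \<Longrightarrow> y \<in> topspace Y \<Longrightarrow>
      \<forall>\<^sub>F n in sequentially. \<forall>k\<ge>f \<beta> n. (x \<beta>, y) \<in> e n k"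
    by blast
  obtain h where h: "\<And>\<beta>. \<beta> \<in> underS \<kappa> \<alpha> \<Longrightarrow> f \<beta> \<le>\<^sup>* h"
    using bounded_if_below_bounding_number[OF assms(1,2) \<alpha>(1)] by blast
  \<comment> \<open>One index meets both demands: \<open>p n\<close> in \<open>I\<close> with
    \<open>n \<le> p n\<close> handles the sets almost contained in \<open>A\<close>, while
    \<open>h n \<le> p n \<le> m (p n)\<close> handles the \<beta> preceding \<alpha>.\<close>
  have "\<forall>n. \<exists>j\<in>I. max n (h n) \<le> j"
    using A(2) unfolding I_def infinite_nat_iff_unbounded_le by blast
  then obtain p where p: "\<And>n. p n \<in> I" "\<And>n. n \<le> p n" "\<And>n. h n \<le> p n"
    by (metis max.bounded_iff)
  have p_lim: "filterlim p sequentially sequentially"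
    using p(2) by (intro filterlim_at_top_mono[OF filterlim_ident]) auto
  have good_gaps: "\<forall>\<^sub>F n in sequentially. (v, y) \<in> e n (m (p n))"
    if v: "v \<in> ?Z" and y: "y \<in> topspace Y" and fin: "finite (v - A)" for v y
  proof -
    obtain c where c: "v - A \<subseteq> {..<c}"
      using fin finite_nat_iff_bounded by blast
    have "v \<inter> {a j..<a (Suc j)} = {}" if "j \<in> I" "c \<le> j" for j
      using that c strict_mono_imp_increasing[OF a, of j] by (fastforce simp: I_def)
    then have "\<forall>\<^sub>F n in sequentially. v \<inter> {a (p n)..<a (Suc (p n))} = {}"
      using p(1,2) by (meson eventually_sequentiallyI order_trans)
    moreover have "\<forall>\<^sub>F n in sequentially. \<forall>v\<in>?Z. \<forall>i\<le>p n.
        v \<inter> {a (p n)..<a (Suc (p n))} = {} \<longrightarrow> (v, y) \<in> e i (m (p n))"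
      using gap[OF y] p_lim by (rule eventually_compose_filterlim)
    ultimately show ?thesis
      by eventually_elim (use v p(2) in blast)
  qed
  have main: "\<forall>\<^sub>F n in sequentially. z \<in> e n (m (p n))" if "z \<in> topspace ?P" for z
  proof -
    obtain v y where z: "z = (v, y)" and v: "v \<in> ?Z" and y: "y \<in> topspace Y"
      using \<open>z \<in> topspace ?P\<close> unfolding topP by blast
    show ?thesis
    proof (cases "finite (v - A)")
      case True
      then show ?thesis unfolding z using v y by (intro good_gaps)
    next
      case False
      then have "v \<in> T" using v by auto
      then obtain \<beta> where \<beta>: "\<beta> \<in> Field \<kappa>" "v = x \<beta>" using assms(3) by blast
      \<comment> \<open>If \<beta> did not precede \<alpha>, the tower property would make
        \<open>v - A\<close> finite.\<close>
      have "\<beta> \<noteq> \<alpha>" using False \<beta>(2) \<alpha>(2) by auto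
      moreover have "(\<alpha>, \<beta>) \<notin> \<kappa>"
        using assms(6) False \<alpha> \<beta> \<open>\<beta> \<noteq> \<alpha>\<close> unfolding tower_def by blast
      moreover have "total_on (Field \<kappa>) \<kappa>"
        using assms(1) by (simp add: card_order_on_def well_order_on_def linear_order_on_def)
      ultimately have "\<beta> \<in> underS \<kappa> \<alpha>"
        using \<alpha>(1) \<beta>(1) unfolding total_on_def underS_def by blast
      then have "\<forall>\<^sub>F n in sequentially. f \<beta> n \<le> h n"
        using h unfolding eventually_dominated_def by blast
      then show ?thesis
        using f[OF \<beta>(1) y] unfolding z \<beta>(2)
        by eventually_elim (meson m p(3) order_trans)
    qed
  qed
  have "gamma_cover ?P (range (\<lambda>n. e n (m (p n))))"
    using openin_subset[OF op] proper main by (rule gamma_cover_range)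
  then have "range (\<lambda>n. e n (m (p n))) \<in> \<Gamma> ?P"
    using op unfolding open_gamma_covers_def by blast
  then show "\<exists>U. (\<forall>n. U n \<in> \<U> n) \<and> range U \<in> \<Gamma> ?P"
    using e by (intro exI[of _ "\<lambda>n. e n (m (p n))"]) blast
qed

end
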